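(* Let $r\ge 2$ be an integer and let $m_r$ be the product of all primes $p\le r$. Suppose that each integer $n\in\{1,\ldots,m_r\}$ satisfies at least one of the following: (1) there exists $i\in\{1,\ldots,r\}$ such that $\gcd(n+i,m_r)=1$; (2) there exist $i,j\in\{1,\ldots,r\}$ such that $\gcd(n+i,m_r)=\gcd(n+j,m_r)=2$ and $0<|i-j|<8$. Then $S_r(n)$ is not an integer for every $n\in\mathbb{N}$.
   Context: $\mathbb{N}$ denotes the set of positive integers. For $r\in\mathbb{N}$, the function $S_r:\mathbb{N}\to\mathbb{Q}$ is defined by $S_r(n)=\sum_{k=0}^{n}\frac{k}{k+r}\binom{n}{k}$. *)

theory Defs
  imports Complex_Main "HOL-Computational_Algebra.Primes"
begin

definition S :: "nat \<Rightarrow> nat \<Rightarrow> rat" where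
  "S r n = (\<Sum>k = 0..n. of_nat k / of_nat (k + r) * of_nat (n choose k))"

definition primorial :: "nat \<Rightarrow> nat" where
  "primorial r = \<Prod>{p. prime p \<and> p \<le> r}"

end

theory Submission
  imports Defs "HOL-Number_Theory.Pocklington"
begin

text \<open>
  Since \<open>k/(k+r) = 1 - r/(k+r)\<close>, the sum equals \<open>2^n - r * T\<close> with
  \<open>T = (\<Sum>k\<le>n. (n choose k) / (k+r))\<close>, the integral of \<open>x^(r-1) * (1+x)^n\<close> over \<open>[0,1]\<close>.
  Expanding \<open>x = (1+x) - 1\<close> writes \<open>T\<close> as the alternating sum of the terms
  \<open>(r-1 choose i-1) * (2^(n+i) - 1) / (n+i)\<close> for \<open>1 \<le> i \<le> r\<close>
  (lemma \<open>sum_choose_divide_conv_alternating\<close>). A prime \<open>p > r\<close> divides at most one of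
  \<open>n+1, ..., n+r\<close> and does not divide the binomial coefficients. If it divides \<open>n+i\<close> but not
  \<open>2^(n+i) - 1\<close>, exactly one term has \<open>p\<close> in its denominator, and the sum is not an
  integer (lemma \<open>S_not_Int_if_prime\<close>).

  To find such a prime, write \<open>n+i = 2^s * a\<close> with \<open>a\<close> odd and let \<open>p\<close> be the least prime
  factor of \<open>a\<close>. If \<open>p\<close> divides \<open>2^(n+i) - 1\<close>, then the order of \<open>2\<close> modulo \<open>p\<close>
  divides both \<open>2^s * a\<close> and \<open>p - 1\<close>; as \<open>p - 1\<close> is coprime to \<open>a\<close>, the order divides \<open>2^s\<close>,
  so that \<open>p\<close> divides \<open>2^(2^s) - 1\<close>. For \<open>s = 0, 1, 2\<close> the latter is \<open>1\<close>, \<open>3\<close>, \<open>15\<close>, which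
  is impossible for \<open>p > r\<close> once \<open>r \<ge> 3\<close> (if \<open>s = 1\<close>) or \<open>r \<ge> 5\<close> (if \<open>s = 2\<close>).
  Condition (1) gives \<open>s = 0\<close>. Under condition (2), two even numbers among
  \<open>n+1, ..., n+r\<close> are \<open>2\<close>, \<open>4\<close> or \<open>6\<close> apart, so that \<open>r \<ge> 3\<close>. Either one of them has
  \<open>s = 1\<close>, or both are multiples of \<open>4\<close>; then they are \<open>4\<close> apart, which forces \<open>r \<ge> 5\<close> and
  gives one of them \<open>s = 2\<close>. The argument needs \<open>a > 1\<close>; the case \<open>a = 1\<close> forces \<open>n \<le> 3\<close>,
  where the value of the sum can be examined directly. Finally, both conditions depend only
  on \<open>n\<close> modulo the primorial, so that they hold for all \<open>n\<close>.
\<close>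

section \<open>The sum as an alternating sum over powers of two\<close>

text \<open>Pascal's rule makes both sides satisfy \<open>T (n, q+1) = T (n+1, q) - T (n, q)\<close>, so this is the
  statement that a \<open>q\<close>-fold difference is an alternating binomial sum. The start \<open>q = 0\<close>
  is absorption, \<open>(n choose k) / (k+1) = (n+1 choose k+1) / (n+1)\<close>.\<close>

lemma sum_choose_divide_conv_alternating:
  "(\<Sum>k\<le>n. of_nat (n choose k) / of_nat (k + Suc q)) =
   (\<Sum>j\<le>q. (-1) ^ (q + j) * of_nat (q choose j) * (2 ^ (n + 1 + j) - 1) / (of_nat (n + 1 + j) :: rat))"
proof (induction q arbitrary: n)
  case 0
  have "of_nat (n choose k) / of_nat (k + 1) = (of_nat (Suc n choose Suc k) / of_nat (Suc n) :: rat)" for k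
  proof -
    have "of_nat (Suc k * (Suc n choose Suc k)) = (of_nat (Suc n * (n choose k)) :: rat)"
      by (simp only: Suc_times_binomial_eq mult.commute)
    then show ?thesis
      by (simp only: of_nat_mult Suc_eq_plus1[symmetric])
         (simp add: divide_simps mult.commute del: of_nat_Suc binomial_Suc_Suc)
  qed
  then have "(\<Sum>k\<le>n. of_nat (n choose k) / of_nat (k + 1))
      = (\<Sum>k\<le>n. of_nat (Suc n choose Suc k)) / (of_nat (Suc n) :: rat)"
    by (simp only: sum_divide_distrib)
  also have "(\<Sum>k\<le>n. of_nat (Suc n choose Suc k)) = (2 ^ Suc n - 1 :: rat)"
  proof -
    have "(\<Sum>k\<le>Suc n. Suc n choose k) = 1 + (\<Sum>k\<le>n. Suc n choose Suc k)"
      by (subst sum.atMost_Suc_shift) simp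
    then have "2 ^ Suc n = 1 + (\<Sum>k\<le>n. Suc n choose Suc k)"
      by (simp only: choose_row_sum)
    then have "of_nat (2 ^ Suc n) = (of_nat (1 + (\<Sum>k\<le>n. Suc n choose Suc k)) :: rat)"
      by (simp only:)
    then show ?thesis
      by (simp only: of_nat_add of_nat_sum of_nat_power) simp
  qed
  finally show ?case by simp
next
  case (Suc q)
  define g where "g n = (2 ^ (n + 1) - 1) / (of_nat (n + 1) :: rat)" for n
  define T where "T n q = (\<Sum>k\<le>n. of_nat (n choose k) / (of_nat (k + Suc q) :: rat))" for n q
  define R where "R n q = (\<Sum>j\<le>q. (-1) ^ (q + j) * of_nat (q choose j) * g (n + j))" for n q
  have IH: "T n q = R n q" for n
    using Suc.IH[of n] by (simp add: T_def R_def g_def add.commute add.left_commute)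
  have T_step: "T (Suc n) q = T n q + T n (Suc q)"
  proof -
    have "T (Suc n) q = 1 / of_nat (Suc q)
        + (\<Sum>k\<le>n. of_nat (Suc n choose Suc k) / of_nat (Suc k + Suc q))"
      unfolding T_def by (subst sum.atMost_Suc_shift) simp
    also have "\<dots> = (1 / of_nat (Suc q) + (\<Sum>k\<le>n. of_nat (n choose Suc k) / of_nat (Suc k + Suc q)))
        + T n (Suc q)"
      unfolding T_def by (simp add: add_divide_distrib sum.distrib)
    also have "1 / of_nat (Suc q) + (\<Sum>k\<le>n. of_nat (n choose Suc k) / of_nat (Suc k + Suc q))
        = (\<Sum>k\<le>Suc n. of_nat (n choose k) / (of_nat (k + Suc q) :: rat))"
      by (subst sum.atMost_Suc_shift) simp
    also have "\<dots> = T n q"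
      unfolding T_def by simp
    finally show ?thesis .
  qed
  have R_step: "R n (Suc q) = R (Suc n) q - R n q"
  proof -
    have "R n (Suc q) = (-1) ^ Suc q * g n
        + (\<Sum>j\<le>q. (-1) ^ (q + j) * of_nat (Suc q choose Suc j) * g (Suc n + j))"
      unfolding R_def by (subst sum.atMost_Suc_shift) simp
    also have "\<dots> = R (Suc n) q
        - ((-1) ^ q * g n + (\<Sum>j\<le>q. (-1) ^ (q + Suc j) * of_nat (q choose Suc j) * g (n + Suc j)))"
      unfolding R_def by (simp add: algebra_simps sum.distrib sum_negf)
    also have "(-1) ^ q * g n + (\<Sum>j\<le>q. (-1) ^ (q + Suc j) * of_nat (q choose Suc j) * g (n + Suc j))
        = (\<Sum>j\<le>Suc q. (-1) ^ (q + j) * of_nat (q choose j) * g (n + j))"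
      by (subst sum.atMost_Suc_shift) simp
    also have "\<dots> = R n q"
      unfolding R_def by simp
    finally show ?thesis .
  qed
  have "T n (Suc q) = R n (Suc q)"
    using T_step R_step IH by simp
  then show ?case
    by (simp add: T_def R_def g_def add.commute add.left_commute)
qed

lemma S_conv_alternating:
  "S (Suc q) n = 2 ^ n - of_nat (Suc q) *
   (\<Sum>j\<le>q. (-1) ^ (q + j) * of_nat (q choose j) * (2 ^ (n + 1 + j) - 1) / of_nat (n + 1 + j))"
proof -
  have summand: "of_nat k / of_nat (k + Suc q) * of_nat (n choose k)
      = of_nat (n choose k) - of_nat (Suc q) * (of_nat (n choose k) / (of_nat (k + Suc q) :: rat))" for k
  proof -
    have "of_nat k = (of_nat (k + Suc q) - of_nat (Suc q) :: rat)"
      by simp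
    moreover have "of_nat (k + Suc q) \<noteq> (0 :: rat)"
      by (simp only: of_nat_eq_0_iff)
    moreover have "a / b * d = d - c * (d / b)" if "a = b - c" "b \<noteq> 0" for a b c d :: rat
      using that by (simp add: diff_divide_distrib left_diff_distrib)
    ultimately show ?thesis
      by blast
  qed
  have row: "(\<Sum>k\<le>n. of_nat (n choose k)) = (2 ^ n :: rat)"
    using choose_row_sum[of n] by (metis of_nat_numeral of_nat_power of_nat_sum)
  show ?thesis
    unfolding S_def summand sum_subtractf sum_choose_divide_conv_alternating[symmetric]
    by (simp only: atLeast0AtMost row sum_distrib_left)
qed

section \<open>A prime that obstructs integrality\<close>

text \<open>Multiplying by the product \<open>D\<close> of all \<open>n+1+j\<close> with \<open>j \<noteq> i\<close>, which is prime to \<open>p\<close>, makes every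
  term but the \<open>i\<close>-th an integer; that term keeps \<open>p\<close> in its denominator.\<close>

lemma S_not_Int_if_prime:
  assumes p: "prime p" "Suc q < p" and "i \<le> q" and dvd: "p dvd n + 1 + i"
    and ndvd: "\<not> p dvd 2 ^ (n + 1 + i) - 1"
  shows "S (Suc q) n \<notin> \<int>"
proof
  assume int: "S (Suc q) n \<in> \<int>"
  define t where "t j = (-1) ^ (q + j) * of_nat (q choose j) * (2 ^ (n + 1 + j) - 1) / (of_nat (n + 1 + j) :: rat)" for j
  define D where "D = (\<Prod>j\<in>{..q} - {i}. n + 1 + j)"
  define C where "C = Suc q * (q choose i) * (2 ^ (n + 1 + i) - 1) * D"
  have "of_nat (Suc q) * (\<Sum>j\<le>q. t j) = 2 ^ n - S (Suc q) n"
    unfolding S_conv_alternating t_def by simp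
  with int have "of_nat (Suc q) * (\<Sum>j\<le>q. t j) \<in> \<int>"
    by simp
  then have total: "of_nat D * (of_nat (Suc q) * (\<Sum>j\<le>q. t j)) \<in> \<int>"
    by (rule Ints_mult[OF Ints_of_nat])
  have rest: "of_nat D * t j \<in> \<int>" if j: "j \<in> {..q} - {i}" for j
  proof -
    have "n + 1 + j dvd D"
      unfolding D_def using j by (intro dvd_prodI) auto
    then obtain e where "D = (n + 1 + j) * e" ..
    moreover have "of_nat (n + 1 + j) \<noteq> (0 :: rat)"
      by (simp only: of_nat_eq_0_iff)
    ultimately have "of_nat D / of_nat (n + 1 + j) = (of_nat e :: rat)"
      by (simp only: of_nat_mult nonzero_mult_div_cancel_left not_False_eq_True)
    moreover have "of_nat D * t j
        = of_nat D / of_nat (n + 1 + j) * ((-1) ^ (q + j) * of_nat (q choose j) * (2 ^ (n + 1 + j) - 1))"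
      by (simp add: t_def)
    ultimately show ?thesis
      by simp
  qed
  have "of_nat D * (of_nat (Suc q) * (\<Sum>j\<le>q. t j))
      = of_nat D * of_nat (Suc q) * t i + of_nat (Suc q) * (\<Sum>j\<in>{..q} - {i}. of_nat D * t j)"
    using \<open>i \<le> q\<close>
    by (subst sum.remove[of _ i]) (simp_all add: algebra_simps sum_distrib_left)
  moreover have "of_nat (Suc q) * (\<Sum>j\<in>{..q} - {i}. of_nat D * t j) \<in> \<int>"
    by (intro Ints_mult[OF Ints_of_nat] Ints_sum rest)
  ultimately have "of_nat D * of_nat (Suc q) * t i \<in> \<int>"
    using total by (metis Ints_diff add_diff_cancel_right')
  then have "(-1) ^ (q + i) * (of_nat D * of_nat (Suc q) * t i) \<in> \<int>"
    by (rule Ints_mult[rotated]) simp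
  also have "(-1) ^ (q + i) * (of_nat D * of_nat (Suc q) * t i) = of_nat C / of_nat (n + 1 + i)"
  proof -
    have "of_nat (2 ^ (n + 1 + i) - 1) = (2 ^ (n + 1 + i) - 1 :: rat)"
      by (subst of_nat_diff) auto
    moreover have "(-1) ^ (q + i) * (-1) ^ (q + i) = (1 :: rat)"
      by (simp flip: power_mult_distrib)
    ultimately show ?thesis
      unfolding C_def t_def of_nat_mult by (simp add: ac_simps)
  qed
  finally obtain z :: int where "of_nat C / of_nat (n + 1 + i) = (of_int z :: rat)"
    by (auto elim: Ints_cases)
  then have "of_nat C = (of_int z * of_nat (n + 1 + i) :: rat)"
    by (simp add: field_simps del: of_nat_Suc of_nat_add)
  then have "of_int (int C) = (of_int (z * int (n + 1 + i)) :: rat)"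
    by simp
  then have "int C = z * int (n + 1 + i)"
    by (simp only: of_int_eq_iff)
  then have "n + 1 + i dvd C"
    by (metis dvd_triv_right int_dvd_int_iff)
  with dvd have "p dvd C"
    by (rule dvd_trans)
  then have "p dvd Suc q \<or> p dvd q choose i \<or> p dvd D"
    using ndvd unfolding C_def by (simp only: prime_dvd_mult_iff[OF \<open>prime p\<close>]) blast
  then consider "p dvd Suc q" | "p dvd q choose i" | "p dvd D"
    by blast
  then show False
  proof cases
    case 1
    then have "p \<le> Suc q"
      by (rule dvd_imp_le) simp
    with p show False by simp
  next
    case 2
    \<comment> \<open>The binomial coefficient divides \<open>fact q\<close>, all of whose prime factors are at most \<open>q\<close>.\<close>
    then have "p dvd fact q"
      using binomial_fact_lemma[OF \<open>i \<le> q\<close>] by (metis dvd_mult)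
    with p show False by (simp add: prime_dvd_fact_iff)
  next
    case 3
    then obtain j where j: "j \<le> q" "j \<noteq> i" "p dvd n + 1 + j"
      unfolding D_def using \<open>prime p\<close> by (auto simp: prime_dvd_prod_iff)
    with dvd have "int p dvd int (n + 1 + j) - int (n + 1 + i)"
      by (intro dvd_diff) (simp_all only: int_dvd_int_iff)
    then have "int p dvd int j - int i"
      by simp
    then have "int p \<le> \<bar>int j - int i\<bar>"
      using j by (intro zdvd_imp_le) auto
    with j \<open>i \<le> q\<close> p show False by linarith
  qed
qed

section \<open>Primes dividing both \<open>m\<close> and \<open>2^m - 1\<close>\<close>

text \<open>The witness is the least prime factor \<open>p\<close> of \<open>a\<close>: every prime factor of \<open>p - 1\<close> is
  smaller than \<open>p\<close>, so \<open>p - 1\<close> is coprime to \<open>a\<close>.\<close>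

lemma odd_prime_dvd_two_power_minus_1:
  fixes a :: nat
  assumes "odd a" "a > 1"
  obtains p where "prime p" "p dvd a" "p dvd 2 ^ (2 ^ s * a) - 1 \<Longrightarrow> p dvd 2 ^ (2 ^ s) - 1"
proof -
  have ex: "\<exists>p. prime p \<and> p dvd a"
    using \<open>a > 1\<close> by (intro prime_factor_nat) auto
  define p where "p = (LEAST p. prime p \<and> p dvd a)"
  have p: "prime p" "p dvd a"
    using LeastI_ex[OF ex] by (auto simp: p_def)
  have least: "p \<le> l" if "prime l" "l dvd a" for l
    unfolding p_def using that by (intro Least_le) simp
  have "odd p"
    using p \<open>odd a\<close> by auto
  have dvd_iff: "p dvd 2 ^ k - 1 \<longleftrightarrow> ord p 2 dvd k" for k
    by (subst ord_divides[symmetric]) (simp add: cong_altdef_nat)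
  have "p dvd 2 ^ (2 ^ s) - 1" if "p dvd 2 ^ (2 ^ s * a) - 1"
  proof -
    have 1: "ord p 2 dvd 2 ^ s * a"
      using that by (simp only: dvd_iff)
    have "\<not> p dvd 2"
      using p \<open>odd p\<close> by (metis even_numeral primes_dvd_imp_eq two_is_prime_nat)
    then have "ord p 2 dvd p - 1"
      unfolding ord_divides[symmetric] by (rule fermat_theorem[OF \<open>prime p\<close>])
    moreover have "coprime (p - 1) a"
    proof (rule ccontr)
      assume "\<not> coprime (p - 1) a"
      then obtain l where l: "prime l" "l dvd p - 1" "l dvd a"
        using prime_factor_nat[of "gcd (p - 1) a"] by (auto simp: coprime_iff_gcd_eq_1)
      have "p - 1 > 0"
        using prime_gt_1_nat[OF \<open>prime p\<close>] by simp
      with l have "l \<le> p - 1"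
        by (intro dvd_imp_le)
      with least[OF l(1,3)] \<open>p - 1 > 0\<close> show False by simp
    qed
    ultimately have "coprime (ord p 2) a"
      by (meson coprime_divisors dvd_refl)
    with 1 have "ord p 2 dvd 2 ^ s"
      by (simp add: coprime_dvd_mult_left_iff)
    then show ?thesis
      by (simp only: dvd_iff)
  qed
  with p that show ?thesis by blast
qed

text \<open>The two bounds by \<open>r\<close> are incompatible for a prime dividing both \<open>a\<close> and \<open>2^(2^s) - 1\<close>, so
  the least prime factor of \<open>a\<close> does not divide \<open>2^(n+i) - 1\<close>.\<close>

lemma S_not_Int_if_two_power_times:
  assumes i: "i \<in> {1..r}" and eq: "n + i = 2 ^ s * a" and a: "odd a" "a > 1"
    and large: "\<And>p. prime p \<Longrightarrow> p dvd a \<Longrightarrow> r < p"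
    and small: "\<And>p. prime p \<Longrightarrow> p dvd 2 ^ (2 ^ s) - 1 \<Longrightarrow> p \<le> r"
  shows "S r n \<notin> \<int>"
proof -
  obtain p where p: "prime p" "p dvd a" "p dvd 2 ^ (2 ^ s * a) - 1 \<Longrightarrow> p dvd 2 ^ (2 ^ s) - 1"
    using odd_prime_dvd_two_power_minus_1[OF a, of s] by blast
  then have "r < p"
    using large by blast
  have "\<not> p dvd 2 ^ (n + i) - 1"
    using p small[of p] \<open>r < p\<close> unfolding eq by force
  moreover have "p dvd n + i"
    unfolding eq using p by simp
  moreover obtain q where "r = Suc q"
    using i by (cases r) auto
  moreover obtain j where "i = Suc j"
    using i by (cases i) auto
  ultimately show ?thesis
    using S_not_Int_if_prime[of p q j n] \<open>prime p\<close> \<open>r < p\<close> i by simp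
qed

section \<open>Small \<open>n\<close>\<close>

lemma S_1_not_Int:
  assumes "r \<ge> 1"
  shows "S r 1 \<notin> \<int>"
proof
  assume "S r 1 \<in> \<int>"
  then obtain z where z: "S r 1 = of_int z"
    by (auto elim: Ints_cases)
  have "S r 1 = 1 / (of_nat r + 1)"
    by (simp add: S_def add.commute)
  then have "0 < S r 1" "S r 1 < 1"
    using assms by simp_all
  then show False
    unfolding z by simp
qed

lemma S_2_not_Int:
  assumes "r \<ge> 5"
  shows "S r 2 \<notin> \<int>"
proof
  assume "S r 2 \<in> \<int>"
  then obtain z where z: "S r 2 = of_int z"
    by (auto elim: Ints_cases)
  define x where "x = (of_nat r :: rat)"
  have x: "x \<ge> 5"
    using assms of_nat_mono[of 5 r, where ?'a = rat] by (simp add: x_def)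
  have eq: "S r 2 = 2 / (x + 1) + 2 / (x + 2)"
    by (simp add: S_def x_def numeral_2_eq_2 add.commute)
  have "2 / (x + 1) \<le> 2 / 6" "2 / (x + 2) \<le> 2 / 7"
    using x by (intro divide_left_mono; simp)+
  moreover have "0 < 2 / (x + 1)" "0 < 2 / (x + 2)"
    using x by auto
  ultimately have "0 < S r 2" "S r 2 < 1"
    unfolding eq by linarith+
  then show False
    unfolding z by simp
qed

text \<open>The value lies strictly between \<open>0\<close> and \<open>2\<close>. With \<open>m = r + 2\<close>, the value \<open>1\<close> would mean
  \<open>m^2 * (m - 12) = m - 6\<close>, where the two sides have different signs or sizes for \<open>m \<ge> 7\<close>.\<close>

lemma S_3_not_Int:
  assumes "r \<ge> 5"
  shows "S r 3 \<notin> \<int>"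
proof
  assume "S r 3 \<in> \<int>"
  then obtain z where z: "S r 3 = of_int z"
    by (auto elim: Ints_cases)
  define x where "x = (of_nat r :: rat)"
  have x: "x \<ge> 5"
    using assms of_nat_mono[of 5 r, where ?'a = rat] by (simp add: x_def)
  have eq: "S r 3 = 3 / (x + 1) + 6 / (x + 2) + 3 / (x + 3)"
    by (simp add: S_def x_def numeral_3_eq_3 numeral_2_eq_2 add.commute)
  have "3 / (x + 1) \<le> 3 / 6" "6 / (x + 2) \<le> 6 / 7" "3 / (x + 3) \<le> 3 / 8"
    using x by (intro divide_left_mono; simp)+
  moreover have "0 < 3 / (x + 1)" "0 < 6 / (x + 2)" "0 < 3 / (x + 3)"
    using x by auto
  ultimately have "0 < S r 3" "S r 3 < 2"
    unfolding eq by linarith+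
  then have "z = 1"
    unfolding z by simp
  have clear: "3 * b * c + 6 * a * c + 3 * a * b = a * b * c"
    if "a \<noteq> 0" "b \<noteq> 0" "c \<noteq> 0" "3 / a + 6 / b + 3 / c = 1" for a b c :: rat
    using that by (simp add: field_simps)
  from \<open>z = 1\<close> z eq have "3 / (x + 1) + 6 / (x + 2) + 3 / (x + 3) = 1"
    by simp
  then have "3 * (x + 2) * (x + 3) + 6 * (x + 1) * (x + 3) + 3 * (x + 1) * (x + 2)
      = (x + 1) * (x + 2) * (x + 3)"
    using x clear[of "x + 1" "x + 2" "x + 3"] by simp
  then have cubic: "(x + 2) * (x + 2) * (x - 10) = x - 4"
    by (simp add: algebra_simps)
  show False
  proof (cases "r \<le> 10")
    case True
    then have "x \<le> 10"
      using of_nat_mono[of r 10, where ?'a = rat] by (simp add: x_def)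
    then have "(x + 2) * (x + 2) * (x - 10) \<le> 0"
      using x by (intro mult_nonneg_nonpos) auto
    with cubic x show False by linarith
  next
    case False
    then have "x \<ge> 11"
      using of_nat_mono[of 11 r, where ?'a = rat] by (simp add: x_def)
    then have "(x + 2) * 1 * 1 \<le> (x + 2) * (x + 2) * (x - 10)"
      by (intro mult_mono) auto
    also note cubic
    finally show False by simp
  qed
qed

section \<open>The two conditions\<close>

lemma dvd_primorial: "prime p \<Longrightarrow> p \<le> r \<Longrightarrow> p dvd primorial r"
  unfolding primorial_def by (rule dvd_prodI) (auto intro: finite_subset[of _ "{..r}"])

lemma primorial_pos: "primorial r > 0"
  unfolding primorial_def by (rule prod_pos) (auto intro: prime_gt_0_nat)

lemma odd_prime_gt_if_gcd_primorial_dvd_2: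
  assumes "gcd N (primorial r) dvd 2" "prime p" "p dvd N" "odd p"
  shows "r < p"
proof (rule ccontr)
  assume "\<not> r < p"
  then have "p dvd gcd N (primorial r)"
    using assms by (simp add: dvd_primorial)
  then have "p dvd 2"
    using assms(1) by (rule dvd_trans)
  then show False
    using assms by (metis even_numeral primes_dvd_imp_eq two_is_prime_nat)
qed

text \<open>The case \<open>n + i \<equiv> 2\<close> modulo \<open>4\<close>: the only prime factor of \<open>2^2 - 1\<close> is \<open>3\<close>.\<close>

lemma S_not_Int_if_mod_4:
  assumes "r \<ge> 3" "n \<ge> 1" "i \<in> {1..r}" "gcd (n + i) (primorial r) = 2" "(n + i) mod 4 = 2"
  shows "S r n \<notin> \<int>"
proof -
  define a where "a = (n + i) div 2"
  have "n + i = 2 * a" and "odd a"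
    using assms(5) unfolding a_def by presburger+
  then have a: "n + i = 2 ^ 1 * a" "odd a"
    by simp_all
  show ?thesis
  proof (cases "a = 1")
    case True
    with a assms have "n = 1" by simp
    with S_1_not_Int \<open>r \<ge> 3\<close> show ?thesis by simp
  next
    case False
    with a have "a > 1"
      by (cases a) auto
    with assms(3) a(1,2) show ?thesis
    proof (rule S_not_Int_if_two_power_times)
      fix p :: nat
      assume p: "prime p" "p dvd a"
      moreover have "odd p"
        using a p by auto
      ultimately show "r < p"
        using odd_prime_gt_if_gcd_primorial_dvd_2[of "n + i" r p] assms(4) a by simp
    next
      fix p :: nat
      assume "prime p" "p dvd 2 ^ (2 ^ 1) - 1"
      then have "p \<le> 3"
        by (intro dvd_imp_le) auto
      with \<open>r \<ge> 3\<close> show "p \<le> r" by simp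
    qed
  qed
qed

text \<open>The case \<open>n + i \<equiv> 4\<close> modulo \<open>8\<close>: the prime factors of \<open>2^4 - 1\<close> are \<open>3\<close> and \<open>5\<close>.\<close>

lemma S_not_Int_if_mod_8:
  assumes "r \<ge> 5" "n \<ge> 1" "i \<in> {1..r}" "gcd (n + i) (primorial r) = 2" "(n + i) mod 8 = 4"
  shows "S r n \<notin> \<int>"
proof -
  define a where "a = (n + i) div 4"
  have "n + i = 4 * a" and "odd a"
    using assms(5) unfolding a_def by presburger+
  then have a: "n + i = 2 ^ 2 * a" "odd a"
    by simp_all
  show ?thesis
  proof (cases "a = 1")
    case True
    with a assms have "n = 1 \<or> n = 2 \<or> n = 3" by auto
    with S_1_not_Int S_2_not_Int S_3_not_Int \<open>r \<ge> 5\<close> show ?thesis by force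
  next
    case False
    with a have "a > 1"
      by (cases a) auto
    with assms(3) a(1,2) show ?thesis
    proof (rule S_not_Int_if_two_power_times)
      fix p :: nat
      assume p: "prime p" "p dvd a"
      moreover have "odd p"
        using a p by auto
      ultimately show "r < p"
        using odd_prime_gt_if_gcd_primorial_dvd_2[of "n + i" r p] assms(4) a by simp
    next
      fix p :: nat
      assume p: "prime p" "p dvd 2 ^ (2 ^ 2) - 1"
      then have "p dvd 3 * 5"
        by simp
      with \<open>prime p\<close> have "p dvd 3 \<or> p dvd 5"
        by (simp only: prime_dvd_mult_iff)
      then have "p \<le> 5"
        by (auto dest: dvd_imp_le)
      with \<open>r \<ge> 5\<close> show "p \<le> r" by simp
    qed
  qed
qed

lemma S_not_Int_if_coprime_primorial:
  assumes "r \<ge> 2" "n \<ge> 1" "i \<in> {1..r}" "gcd (n + i) (primorial r) = 1"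
  shows "S r n \<notin> \<int>"
proof -
  have "odd (n + i)"
  proof
    assume "even (n + i)"
    with dvd_primorial[of 2 r] \<open>r \<ge> 2\<close> have "2 dvd gcd (n + i) (primorial r)"
      by simp
    with assms(4) show False by simp
  qed
  show ?thesis
  proof (rule S_not_Int_if_two_power_times)
    show "i \<in> {1..r}" "n + i = 2 ^ 0 * (n + i)" "odd (n + i)" "n + i > 1"
      using assms \<open>odd (n + i)\<close> by auto
  next
    fix p :: nat
    assume p: "prime p" "p dvd n + i"
    moreover have "odd p"
      using p \<open>odd (n + i)\<close> dvd_trans by blast
    ultimately show "r < p"
      using odd_prime_gt_if_gcd_primorial_dvd_2[of "n + i" r p] assms(4) by simp
  next
    fix p :: nat
    assume "prime p" "p dvd 2 ^ (2 ^ 0) - 1"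
    then show "p \<le> r" by simp
  qed
qed

text \<open>Two even numbers that are \<open>2\<close> or \<open>6\<close> apart include one that is \<open>2\<close> modulo \<open>4\<close>. Two multiples of
  \<open>4\<close> that are \<open>4\<close> apart include one that is \<open>4\<close> modulo \<open>8\<close>.\<close>

lemma S_not_Int_if_gcd_primorial_eq_2:
  assumes "n \<ge> 1" and i: "i \<in> {1..r}" "gcd (n + i) (primorial r) = 2"
    and j: "j \<in> {1..r}" "gcd (n + j) (primorial r) = 2"
    and "0 < \<bar>int i - int j\<bar>" "\<bar>int i - int j\<bar> < 8"
  shows "S r n \<notin> \<int>"
proof -
  have even: "even (n + i)" "even (n + j)"
    using i(2) j(2) by (metis gcd_dvd1)+
  then have cases: "(n + i) mod 4 = 2 \<or> (n + j) mod 4 = 2 \<or> (n + i) mod 4 = 0 \<and> (n + j) mod 4 = 0"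
    by presburger
  from even have "even (int i - int j)"
    by simp
  then have gap: "\<bar>int i - int j\<bar> \<ge> 2"
    using assms(6) by presburger
  with i(1) j(1) have "r \<ge> 3" by auto
  consider "(n + i) mod 4 = 2" | "(n + j) mod 4 = 2"
    | "(n + i) mod 4 = 0" "(n + j) mod 4 = 0"
    using cases by (elim disjE conjE)
  then show ?thesis
  proof cases
    case 1
    show ?thesis
      by (rule S_not_Int_if_mod_4) fact+
  next
    case 2
    show ?thesis
      by (rule S_not_Int_if_mod_4) fact+
  next
    case 3
    then have "int 4 dvd int (n + i) - int (n + j)"
      by (intro dvd_diff) (simp_all only: int_dvd_int_iff mod_eq_0_iff_dvd)
    then have "4 dvd int i - int j"
      by simp
    then have 4: "\<bar>int i - int j\<bar> = 4"
      using assms(6,7) by presburger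
    with i(1) j(1) have "r \<ge> 5" by auto
    have "(n + i) mod 8 = 4 \<or> (n + j) mod 8 = 4"
    proof -
      have *: "x mod 8 = 4 \<or> (x + 4) mod 8 = 4" if "x mod 4 = 0" for x :: nat
        using that by presburger
      have "n + j = n + i + 4 \<or> n + i = n + j + 4"
        using 4 by linarith
      then show ?thesis
        using *[OF 3(1)] *[OF 3(2)] by metis
    qed
    then show ?thesis
      using S_not_Int_if_mod_8[OF \<open>r \<ge> 5\<close> \<open>n \<ge> 1\<close> i] S_not_Int_if_mod_8[OF \<open>r \<ge> 5\<close> \<open>n \<ge> 1\<close> j]
      by (elim disjE)
  qed
qed

theorem theorem1p1:
  fixes r :: nat
  assumes "r \<ge> 2"
    and "\<forall>n \<in> {1..primorial r}.
           (\<exists>i \<in> {1..r}. gcd (n + i) (primorial r) = 1) \<or>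
           (\<exists>i \<in> {1..r}. \<exists>j \<in> {1..r}.
              gcd (n + i) (primorial r) = 2 \<and> gcd (n + j) (primorial r) = 2 \<and>
              0 < \<bar>int i - int j\<bar> \<and> \<bar>int i - int j\<bar> < 8)"
  shows "\<forall>n::nat. n \<ge> 1 \<longrightarrow> S r n \<notin> \<int>"
proof (intro allI impI)
  fix n :: nat
  assume "n \<ge> 1"
  define m where "m = primorial r"
  \<comment> \<open>The representative of \<open>n\<close> modulo \<open>m\<close> in \<open>{1..m}\<close> rather than in \<open>{0..<m}\<close>.\<close>
  define n' where "n' = (n - 1) mod m + 1"
  have "n' \<in> {1..m}"
    using primorial_pos[of r] by (simp add: n'_def m_def Suc_leI)
  have gcd_eq: "gcd (n' + k) m = gcd (n + k) m" for k
  proof -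
    have "n + k = (n - 1) + (1 + k)" "n' + k = (n - 1) mod m + (1 + k)"
      using \<open>n \<ge> 1\<close> by (simp_all add: n'_def)
    then have "(n' + k) mod m = (n + k) mod m"
      by (simp only: mod_add_left_eq)
    then show ?thesis
      by (metis gcd_mod_left gcd.commute gcd_red_nat)
  qed
  from assms(2) \<open>n' \<in> {1..m}\<close>
  have "(\<exists>i \<in> {1..r}. gcd (n' + i) m = 1) \<or>
      (\<exists>i \<in> {1..r}. \<exists>j \<in> {1..r}. gcd (n' + i) m = 2 \<and> gcd (n' + j) m = 2 \<and>
         0 < \<bar>int i - int j\<bar> \<and> \<bar>int i - int j\<bar> < 8)"
    unfolding m_def by blast
  then show "S r n \<notin> \<int>"
    unfolding gcd_eq unfolding m_def
    by (elim disjE bexE conjE)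
      (rule S_not_Int_if_coprime_primorial[OF assms(1) \<open>n \<ge> 1\<close>]
        S_not_Int_if_gcd_primorial_eq_2[OF \<open>n \<ge> 1\<close>]; assumption)+
qed

end
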